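(* Let $L$ be a finite lattice and let $\mathfrak p$ and $\mathfrak q$ be distinct prime intervals in $L$. Then $\mathfrak q$ is collapsed by $\operatorname{con}(\mathfrak p)$ if and only if $\mathfrak p$ is prime-projective to $\mathfrak q$, that is, if and only if there exists a sequence of pairwise distinct prime intervals $\mathfrak p = \mathfrak r_0, \mathfrak r_1, \dots, \mathfrak r_n = \mathfrak q$ of $L$ such that $\mathfrak r_i$ is prime-perspective to $\mathfrak r_{i+1}$ for every $i = 0, \dots, n-1$.
   Context: For an interval $I$ of a lattice write $I = [0_I, 1_I]$. A prime interval is an interval $\mathfrak p = [0_{\mathfrak p}, 1_{\mathfrak p}]$ with $0_{\mathfrak p} \prec 1_{\mathfrak p}$ (i.e. $1_{\mathfrak p}$ covers $0_{\mathfrak p}$). For a prime interval $\mathfrak p$ of $L$, $\operatorname{con}(\mathfrak p)$ is the smallest congruence of $L$ that identifies $0_{\mathfrak p}$ and $1_{\mathfrak p}$. A congruence collapses an interval $[a,b]$ if it identifies $a$ and $b$. Perspectivity: $[a,b]$ is up-perspective to $[c,d]$ if $a = b \wedge c$ and $d = b \vee c$; $[a,b]$ is down-perspective to $[c,d]$ if $b = a \vee d$ and $c = a \wedge d$. Let $\mathfrak p, \mathfrak q$ be prime intervals. $\mathfrak p$ is prime-perspective down to $\mathfrak q$ if $\mathfrak p$ is down-perspective to the interval $[0_{\mathfrak p} \wedge 1_{\mathfrak q}, 1_{\mathfrak q}]$ and $\mathfrak q$ is contained in $[0_{\mathfrak p} \wedge 1_{\mathfrak q}, 1_{\mathfrak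 q}]$; equivalently, $0_{\mathfrak p} \vee 1_{\mathfrak q} = 1_{\mathfrak p}$ and $0_{\mathfrak p} \wedge 1_{\mathfrak q} \le 0_{\mathfrak q}$. Prime-perspective up is defined dually: $1_{\mathfrak p} \wedge 0_{\mathfrak q} = 0_{\mathfrak p}$ and $1_{\mathfrak q} \le 1_{\mathfrak p} \vee 0_{\mathfrak q}$. $\mathfrak p$ is prime-perspective to $\mathfrak q$ if it is prime-perspective up or prime-perspective down to $\mathfrak q$. Prime-projectivity is the transitive closure of the relation of prime-perspectivity on the prime intervals of $L$. *)

theory Defs
  imports Main
begin

text \<open>A nonempty interval \<open>[a, b]\<close> is encoded by the pair of its end points, so distinct
  intervals are distinct pairs.\<close>

type_synonym 'a interval = "'a \<times> 'a"

abbreviation bottom :: "'a interval \<Rightarrow> 'a" where "bottom \<equiv> fst"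

abbreviation top_elt :: "'a interval \<Rightarrow> 'a" where "top_elt \<equiv> snd"

definition interval_subset :: "'a::order interval \<Rightarrow> 'a interval \<Rightarrow> bool" where
  "interval_subset I J \<longleftrightarrow> {bottom I..top_elt I} \<subseteq> {bottom J..top_elt J}"

definition covered_by :: "'a::order \<Rightarrow> 'a \<Rightarrow> bool" where
  "covered_by a b \<longleftrightarrow> a < b \<and> \<not> (\<exists>c. a < c \<and> c < b)"

definition prime_interval :: "'a::order interval \<Rightarrow> bool" where
  "prime_interval p \<longleftrightarrow> covered_by (bottom p) (top_elt p)"

definition lattice_congruence :: "('a::lattice \<times> 'a) set \<Rightarrow> bool" where
  "lattice_congruence \<theta> \<longleftrightarrow> equiv UNIV \<theta> \<and>
     (\<forall>a b c d. (a, b) \<in> \<theta> \<longrightarrow> (c, d) \<in> \<theta> \<longrightarrow>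
        (inf a c, inf b d) \<in> \<theta> \<and> (sup a c, sup b d) \<in> \<theta>)"

definition collapses :: "('a::lattice \<times> 'a) set \<Rightarrow> 'a interval \<Rightarrow> bool" where
  "collapses \<theta> I \<longleftrightarrow> (bottom I, top_elt I) \<in> \<theta>"

definition con :: "'a::lattice interval \<Rightarrow> ('a \<times> 'a) set" where
  "con p = \<Inter>{\<theta>. lattice_congruence \<theta> \<and> collapses \<theta> p}"

lemma mem_con_iff:
  "x \<in> con p \<longleftrightarrow> (\<forall>\<theta>. lattice_congruence \<theta> \<longrightarrow> collapses \<theta> p \<longrightarrow> x \<in> \<theta>)"
  by (auto simp: con_def)

lemma lattice_congruence_con: "lattice_congruence (con p)"
proof -
  have "equiv UNIV (con p)"
  proof (rule equivI)
    show "con p \<subseteq> UNIV \<times> UNIV"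
      by simp
    show "refl (con p)"
      by (simp add: mem_con_iff lattice_congruence_def equiv_def refl_on_def)
    show "sym (con p)"
      by (rule symI) (meson mem_con_iff lattice_congruence_def equivE symD)
    show "trans (con p)"
      by (rule transI) (meson mem_con_iff lattice_congruence_def equivE transD)
  qed
  moreover have "(inf a c, inf b d) \<in> con p \<and> (sup a c, sup b d) \<in> con p"
    if "(a, b) \<in> con p" "(c, d) \<in> con p" for a b c d
    using that by (simp add: mem_con_iff lattice_congruence_def)
  ultimately show ?thesis
    unfolding lattice_congruence_def by simp
qed

lemma collapses_con: "collapses (con p) p"
  by (simp add: con_def collapses_def)

lemma con_least: "lattice_congruence \<theta> \<Longrightarrow> collapses \<theta> p \<Longrightarrow> con p \<subseteq> \<theta>"
  by (auto simp: con_def)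

definition up_perspective :: "'a::lattice interval \<Rightarrow> 'a interval \<Rightarrow> bool" where
  "up_perspective I J \<longleftrightarrow>
     bottom I = inf (top_elt I) (bottom J) \<and> top_elt J = sup (top_elt I) (bottom J)"

definition down_perspective :: "'a::lattice interval \<Rightarrow> 'a interval \<Rightarrow> bool" where
  "down_perspective I J \<longleftrightarrow>
     top_elt I = sup (bottom I) (top_elt J) \<and> bottom J = inf (bottom I) (top_elt J)"

definition prime_perspective_down :: "'a::lattice interval \<Rightarrow> 'a interval \<Rightarrow> bool" where
  "prime_perspective_down p q \<longleftrightarrow>
     down_perspective p (inf (bottom p) (top_elt q), top_elt q) \<and>
     interval_subset q (inf (bottom p) (top_elt q), top_elt q)"

definition prime_perspective_up :: "'a::lattice interval \<Rightarrow> 'a interval \<Rightarrow> bool" where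
  "prime_perspective_up p q \<longleftrightarrow>
     up_perspective p (bottom q, sup (top_elt p) (bottom q)) \<and>
     interval_subset q (bottom q, sup (top_elt p) (bottom q))"

lemma prime_perspective_down_iff:
  assumes "prime_interval q"
  shows "prime_perspective_down p q \<longleftrightarrow>
    sup (bottom p) (top_elt q) = top_elt p \<and> inf (bottom p) (top_elt q) \<le> bottom q"
  using assms
  by (auto simp: prime_perspective_down_def down_perspective_def interval_subset_def
      prime_interval_def covered_by_def)

lemma prime_perspective_up_iff:
  assumes "prime_interval q"
  shows "prime_perspective_up p q \<longleftrightarrow>
    inf (top_elt p) (bottom q) = bottom p \<and> top_elt q \<le> sup (top_elt p) (bottom q)"
  using assms
  by (auto simp: prime_perspective_up_def up_perspective_def interval_subset_def
      prime_interval_def covered_by_def)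

definition prime_perspective :: "'a::lattice interval \<Rightarrow> 'a interval \<Rightarrow> bool" where
  "prime_perspective p q \<longleftrightarrow> prime_interval p \<and> prime_interval q \<and>
     (prime_perspective_up p q \<or> prime_perspective_down p q)"

definition prime_projective :: "'a::lattice interval \<Rightarrow> 'a interval \<Rightarrow> bool" where
  "prime_projective = prime_perspective\<^sup>+\<^sup>+"

end

theory Submission
  imports Defs
begin

text \<open>
  Prime-perspectivity moves a collapsed prime interval to a collapsed prime interval, so every
  prime interval reached from \<open>p\<close> is collapsed by \<open>con p\<close>. For the converse, let \<open>S\<close> be any set of
  prime intervals that is closed under prime-perspectivity, call an interval \<^emph>\<open>filled\<close> if all of its
  prime subintervals lie in \<open>S\<close>, and relate \<open>x\<close> to \<open>y\<close> if \<open>[inf x y, sup x y]\<close> is filled. This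
  relation is a congruence. Taking for \<open>S\<close> the prime intervals reached from \<open>p\<close>, it collapses \<open>p\<close>,
  hence contains \<open>con p\<close>; and it collapses a prime interval only if that interval is in \<open>S\<close>.

  That the relation is a congruence rests on one lemma, \<open>filled_above\<close>. It says that filledness
  propagates from \<open>[x, y]\<close> upwards, and it yields both transitivity along chains and
  compatibility with joins; its order dual yields compatibility with meets.
  Let \<open>[x, y]\<close> be filled and let \<open>[a, b]\<close> be a prime interval with \<open>x \<le> a\<close>. If \<open>y \<le> a\<close>, then
  \<open>[a, b]\<close> lies above \<open>y\<close>, where the hypotheses of the lemma put it into \<open>S\<close>. Otherwise take
  \<open>v \<le> y\<close> covering \<open>inf a y\<close>, so that \<open>[inf a y, v]\<close> is in \<open>S\<close>. Either \<open>b \<le> sup a v\<close>,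
  and \<open>[inf a y, v]\<close> is prime-perspective up to \<open>[a, b]\<close>, or there is a lower cover \<open>c\<close> of
  \<open>sup b v\<close> above \<open>sup a v\<close>, and \<open>[c, sup b v]\<close> is prime-perspective down to \<open>[a, b]\<close>. Since
  \<open>a < c\<close>, induction on the number of elements above \<open>a\<close> puts \<open>[c, sup b v]\<close> into \<open>S\<close>.
\<close>

section \<open>Covers in a finite order\<close>

text \<open>Covers and filled intervals are defined over the abstract order rather than over the type
  class, so that the reversed order is an instance as well.\<close>

context order
begin

definition covers :: "'a \<Rightarrow> 'a \<Rightarrow> bool" where
  "covers b a \<longleftrightarrow> a < b \<and> \<not> (\<exists>c. a < c \<and> c < b)"

definition filled :: "('a \<Rightarrow> 'a \<Rightarrow> bool) \<Rightarrow> 'a \<Rightarrow> 'a \<Rightarrow> bool" where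
  "filled S x y \<longleftrightarrow> (\<forall>a b. covers b a \<longrightarrow> x \<le> a \<longrightarrow> b \<le> y \<longrightarrow> S a b)"

lemma filled_mono: "filled S x y \<Longrightarrow> x \<le> x' \<Longrightarrow> y' \<le> y \<Longrightarrow> filled S x' y'"
  unfolding filled_def by (meson order_trans)

lemma filled_trivial: "y \<le> x \<Longrightarrow> filled S x y"
  unfolding filled_def covers_def by (meson leD order_trans)

lemma covers_between: "covers b a \<Longrightarrow> a \<le> c \<Longrightarrow> c \<le> b \<Longrightarrow> c = a \<or> c = b"
  unfolding covers_def by (auto simp: le_less)

lemma ex_cover_below:
  assumes "finite (UNIV :: 'a set)" "a < b"
  obtains v where "covers v a" "v \<le> b"
proof -
  have "finite {c. a < c \<and> c \<le> b}"
    by (rule finite_subset[OF _ assms(1)]) simp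
  moreover have "{c. a < c \<and> c \<le> b} \<noteq> {}"
    using assms(2) by auto
  ultimately obtain v where v: "a < v" "v \<le> b"
    and min: "\<And>c. a < c \<Longrightarrow> c \<le> b \<Longrightarrow> c \<le> v \<Longrightarrow> v = c"
    using finite_has_minimal[of "{c. a < c \<and> c \<le> b}"] by auto
  have "covers v a"
    unfolding covers_def using v min by (metis less_irrefl less_imp_le order_trans)
  with v that show thesis by blast
qed

lemma covers_dual: "order.covers (\<lambda>x y. y < x) a b \<longleftrightarrow> covers b a"
  unfolding order.covers_def[OF dual_order] covers_def by auto

lemma filled_dual:
  "order.filled (\<lambda>x y. y \<le> x) (\<lambda>x y. y < x) (\<lambda>a b. S b a) y x \<longleftrightarrow> filled S x y"
  unfolding order.filled_def[OF dual_order] filled_def covers_dual by auto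

lemma ex_cocover_above:
  assumes "finite (UNIV :: 'a set)" "a < b"
  obtains c where "covers b c" "a \<le> c"
  using order.ex_cover_below[OF dual_order assms] unfolding covers_dual .

end

section \<open>Propagation of filled intervals\<close>

context lattice
begin

text \<open>Closure under prime-perspectivity up and down, in the equational form in which
  \<open>prime_perspective_up_iff\<close> and \<open>prime_perspective_down_iff\<close> give it. Reversing the order
  interchanges the two notions.\<close>

definition closed_up :: "('a \<Rightarrow> 'a \<Rightarrow> bool) \<Rightarrow> bool" where
  "closed_up S \<longleftrightarrow> (\<forall>u v a b. covers v u \<longrightarrow> covers b a \<longrightarrow> S u v \<longrightarrow>
     inf v a = u \<longrightarrow> b \<le> sup v a \<longrightarrow> S a b)"

definition closed_down :: "('a \<Rightarrow> 'a \<Rightarrow> bool) \<Rightarrow> bool" where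
  "closed_down S \<longleftrightarrow> (\<forall>u v a b. covers v u \<longrightarrow> covers b a \<longrightarrow> S u v \<longrightarrow>
     sup u b = v \<longrightarrow> inf u b \<le> a \<longrightarrow> S a b)"

text \<open>The two bounds \<open>w\<close> and \<open>z\<close> make room for two uses. For \<open>w = x\<close> this is transitivity
  along the chain \<open>x \<le> y \<le> z\<close>; for \<open>w = sup x t\<close> and \<open>z = sup y t\<close>, where \<open>[sup w y, z]\<close> is
  trivial, it is compatibility with the join by \<open>t\<close>.\<close>

lemma filled_above:
  assumes fin: "finite (UNIV :: 'a set)"
    and up: "closed_up S" and down: "closed_down S"
    and xy: "filled S x y" and wz: "filled S (sup w y) z"
    and "x \<le> y" "x \<le> w" "y \<le> z"
  shows "filled S w z"
proof -
  have "S a b" if "covers b a" "w \<le> a" "b \<le> z" for a b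
    using that
  proof (induction a arbitrary: b rule: measure_induct_rule[where f = "\<lambda>a. card {c. a < c}"])
    case (less a)
    show ?case
    proof (cases "y \<le> a")
      case True
      then show ?thesis
        using wz less.prems unfolding filled_def by simp
    next
      case False
      then have "inf a y < y"
        by (metis inf_le1 inf_le2 le_less)
      with fin obtain v where v: "covers v (inf a y)" "v \<le> y"
        by (rule ex_cover_below)
      have "x \<le> inf a y"
        using \<open>x \<le> y\<close> \<open>x \<le> w\<close> less.prems(2) by (meson le_inf_iff order_trans)
      then have S_v: "S (inf a y) v"
        using xy v unfolding filled_def by blast
      have lt_v: "inf a y < v"
        using v(1) unfolding covers_def by blast
      show ?thesis
      proof (cases "b \<le> sup a v")
        case True
        have "inf v a = inf a y"
        proof (rule order.antisym)
          show "inf v a \<le> inf a y"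
            using v(2) by (simp add: le_infI1)
          show "inf a y \<le> inf v a"
            using lt_v by (simp add: less_imp_le)
        qed
        moreover have "b \<le> sup v a"
          using True by (simp add: sup_commute)
        ultimately show ?thesis
          using up v(1) less.prems(1) S_v unfolding closed_up_def by blast
      next
        case False
        have "a \<le> b"
          using less.prems(1) unfolding covers_def by (simp add: less_imp_le)
        \<comment> \<open>The prime interval \<open>[c, sup b v]\<close> lies above \<open>w\<close> and below \<open>z\<close> again, but starts at a
          larger element than \<open>a\<close> because \<open>v\<close> is not below \<open>a\<close>.\<close>
        have "sup a v < sup b v"
          using False \<open>a \<le> b\<close> by (metis le_less sup_ge1 sup_mono order_refl)
        with fin obtain c where c: "covers (sup b v) c" "sup a v \<le> c"
          by (rule ex_cocover_above)
        have c_lt: "c < sup b v"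
          using c(1) unfolding covers_def by blast
        have not_b: "\<not> b \<le> c"
          using c(2) c_lt by (meson le_sup_iff leD)
        have "\<not> v \<le> a"
          using lt_v v(2) by (meson le_inf_iff leD)
        then have "a < c"
          using c(2) by (metis le_less le_sup_iff)
        have "card {d. c < d} < card {d. a < d}"
        proof (rule psubset_card_mono)
          show "finite {d. a < d}"
            by (rule finite_subset[OF _ fin]) simp
          show "{d. c < d} \<subset> {d. a < d}"
            using \<open>a < c\<close> by (auto intro: less_trans)
        qed
        moreover have "sup b v \<le> z"
          using less.prems(3) v(2) \<open>y \<le> z\<close> by (meson le_sup_iff order_trans)
        moreover have "w \<le> c"
          using less.prems(2) \<open>a < c\<close> by (meson less_imp_le order_trans)
        ultimately have "S c (sup b v)"
          using less.IH c(1) by blast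
        moreover have "sup c b = sup b v"
          using c(2) c_lt
          by (intro order.antisym) (auto simp: less_imp_le intro: le_supI1 le_supI2)
        moreover have "inf c b \<le> a"
        proof -
          have "a \<le> inf c b"
            using \<open>a \<le> b\<close> \<open>a < c\<close> by (simp add: less_imp_le)
          then have "inf c b = a \<or> inf c b = b"
            using covers_between[OF less.prems(1)] by simp
          then show ?thesis
            using not_b by (metis inf_le1 order_refl)
        qed
        ultimately show ?thesis
          using down c(1) less.prems(1) unfolding closed_down_def by blast
      qed
    qed
  qed
  then show ?thesis unfolding filled_def by blast
qed

lemma filled_trans:
  assumes "finite (UNIV :: 'a set)" "closed_up S" "closed_down S"
    and "filled S x y" "filled S y z" "x \<le> y" "y \<le> z"
  shows "filled S x z"
  using assms by (intro filled_above[of S x y x z]) (auto simp: sup_absorb2)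

lemma filled_sup:
  assumes "finite (UNIV :: 'a set)" "closed_up S" "closed_down S" "filled S x y" "x \<le> y"
  shows "filled S (sup x t) (sup y t)"
proof -
  have "filled S (sup (sup x t) y) (sup y t)"
    by (rule filled_trivial) (auto intro: le_supI1)
  with assms show ?thesis
    by (intro filled_above[of S x y "sup x t" "sup y t"]) auto
qed

lemma closed_up_dual:
  "lattice.closed_up sup (\<lambda>x y. y \<le> x) (\<lambda>x y. y < x) inf (\<lambda>a b. S b a) \<longleftrightarrow> closed_down S"
  unfolding lattice.closed_up_def[OF dual_lattice] closed_down_def covers_dual by blast

lemma closed_down_dual:
  "lattice.closed_down sup (\<lambda>x y. y \<le> x) (\<lambda>x y. y < x) inf (\<lambda>a b. S b a) \<longleftrightarrow> closed_up S"
  unfolding lattice.closed_down_def[OF dual_lattice] closed_up_def covers_dual by blast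

lemma filled_inf:
  assumes "finite (UNIV :: 'a set)" "closed_up S" "closed_down S" "filled S x y" "x \<le> y"
  shows "filled S (inf x t) (inf y t)"
  using lattice.filled_sup[OF dual_lattice, where S = "\<lambda>a b. S b a" and x = y and y = x] assms
  unfolding closed_up_dual closed_down_dual filled_dual by blast

section \<open>The congruence defined by the filled intervals\<close>

text \<open>Shifting \<open>[inf a b, sup a b]\<close> by the join with \<open>sup b c\<close> and by the meet with \<open>inf b c\<close>
  produces two intervals that extend \<open>[inf b c, sup b c]\<close> upwards and downwards to one containing
  both \<open>a\<close> and \<open>c\<close>.\<close>

lemma filled_between_trans:
  assumes S: "finite (UNIV :: 'a set)" "closed_up S" "closed_down S"
    and ab: "filled S (inf a b) (sup a b)" and bc: "filled S (inf b c) (sup b c)"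
  shows "filled S (inf a c) (sup a c)"
proof -
  let ?l = "inf (inf a b) (inf b c)" and ?h = "sup (sup a b) (sup b c)"
  have le: "inf a b \<le> sup a b" "inf b c \<le> sup b c" "inf a b \<le> sup b c" "inf b c \<le> sup a b"
    by (auto intro: le_infI1 le_infI2 le_supI1 le_supI2)
  have upper: "filled S (sup b c) ?h"
    using filled_sup[OF S ab le(1), of "sup b c"] le(3) by (simp add: sup_absorb2)
  have lower: "filled S ?l (inf b c)"
    using filled_inf[OF S ab le(1), of "inf b c"] le(4) by (simp add: inf_absorb2)
  have "filled S (inf b c) ?h"
    by (rule filled_trans[OF S bc upper le(2)]) simp
  then have "filled S ?l ?h"
    by (rule filled_trans[OF S lower _ inf_le2 le_supI2[OF le(2)]])
  then show ?thesis
    by (rule filled_mono) (auto intro: le_infI1 le_infI2 le_supI1 le_supI2)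
qed

lemma filled_between_sup:
  assumes S: "finite (UNIV :: 'a set)" "closed_up S" "closed_down S"
    and ab: "filled S (inf a b) (sup a b)"
  shows "filled S (inf (sup a t) (sup b t)) (sup (sup a t) (sup b t))"
proof -
  have "filled S (sup (inf a b) t) (sup (sup a b) t)"
    by (rule filled_sup[OF S ab]) (simp add: le_infI1)
  then show ?thesis
    by (rule filled_mono) (auto intro: le_infI1 le_supI1 le_supI2)
qed

lemma filled_between_inf:
  assumes S: "finite (UNIV :: 'a set)" "closed_up S" "closed_down S"
    and ab: "filled S (inf a b) (sup a b)"
  shows "filled S (inf (inf a t) (inf b t)) (sup (inf a t) (inf b t))"
proof -
  have "filled S (inf (inf a b) t) (inf (sup a b) t)"
    by (rule filled_inf[OF S ab]) (simp add: le_infI1)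
  then show ?thesis
    by (rule filled_mono) (auto intro: le_infI1 le_infI2 le_supI1)
qed

end

lemma lattice_congruence_filled:
  fixes S :: "'a::{finite,lattice} \<Rightarrow> 'a \<Rightarrow> bool"
  assumes "closed_up S" "closed_down S"
  shows "lattice_congruence {(x, y). filled S (inf x y) (sup x y)}"
    (is "lattice_congruence ?\<theta>")
proof -
  note S = finite_UNIV assms
  have trans: "(a, c) \<in> ?\<theta>" if "(a, b) \<in> ?\<theta>" "(b, c) \<in> ?\<theta>" for a b c
    using that filled_between_trans[OF S] by simp
  have sup: "(sup a t, sup b t) \<in> ?\<theta>" if "(a, b) \<in> ?\<theta>" for a b t
    using that filled_between_sup[OF S] by simp
  have inf: "(inf a t, inf b t) \<in> ?\<theta>" if "(a, b) \<in> ?\<theta>" for a b t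
    using that filled_between_inf[OF S] by simp
  have "equiv UNIV ?\<theta>"
  proof (rule equivI)
    show "?\<theta> \<subseteq> UNIV \<times> UNIV" by simp
    show "refl ?\<theta>"
      by (rule refl_onI) (simp add: filled_trivial)
    show "sym ?\<theta>"
      by (rule symI) (simp add: inf_commute sup_commute)
    show "trans ?\<theta>"
      by (rule transI) (rule trans)
  qed
  moreover have "(inf a c, inf b d) \<in> ?\<theta> \<and> (sup a c, sup b d) \<in> ?\<theta>"
    if ab: "(a, b) \<in> ?\<theta>" and cd: "(c, d) \<in> ?\<theta>" for a b c d
  proof
    show "(inf a c, inf b d) \<in> ?\<theta>"
      using trans[OF inf[OF ab, of c] inf[OF cd, of b, unfolded inf_commute[of _ b]]] .
    show "(sup a c, sup b d) \<in> ?\<theta>"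
      using trans[OF sup[OF ab, of c] sup[OF cd, of b, unfolded sup_commute[of _ b]]] .
  qed
  ultimately show ?thesis
    unfolding lattice_congruence_def by blast
qed

section \<open>Prime-projectivity\<close>

lemma covered_by_iff_covers: "covered_by a b \<longleftrightarrow> covers b a"
  unfolding covered_by_def covers_def ..

lemma prime_perspective_collapses:
  assumes \<theta>: "lattice_congruence \<theta>" and "collapses \<theta> p" and "prime_perspective p q"
  shows "collapses \<theta> q"
proof -
  obtain a b c d where pq: "p = (a, b)" "q = (c, d)"
    by (metis surj_pair)
  have q: "prime_interval q" and "c \<le> d"
    using assms(3) pq
    by (auto simp: prime_perspective_def prime_interval_def covered_by_def less_imp_le)
  have refl: "(x, x) \<in> \<theta>" for x
    using \<theta> by (simp add: lattice_congruence_def equiv_def refl_on_def)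
  have sym: "(y, x) \<in> \<theta>" if "(x, y) \<in> \<theta>" for x y
    using \<theta> that by (meson lattice_congruence_def equivE symD)
  have sup: "(sup x t, sup y t) \<in> \<theta>" and inf: "(inf x t, inf y t) \<in> \<theta>"
    if "(x, y) \<in> \<theta>" for x y t
    using \<theta> that refl[of t] unfolding lattice_congruence_def by blast+
  have ab: "(a, b) \<in> \<theta>"
    using assms(2) pq by (simp add: collapses_def)
  consider "prime_perspective_up p q" | "prime_perspective_down p q"
    using assms(3) unfolding prime_perspective_def by blast
  then have "(c, d) \<in> \<theta>"
  proof cases
    case 1
    then have *: "inf b c = a" "d \<le> sup b c"
      using prime_perspective_up_iff[OF q, of p] pq by auto
    \<comment> \<open>The term is \<open>(c, d)\<close>: the join moves \<open>[a, b]\<close> to \<open>[c, sup b c]\<close>, the meet cuts it at \<open>d\<close>.\<close>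
    have "(inf (sup a c) d, inf (sup b c) d) \<in> \<theta>"
      by (intro inf sup ab)
    moreover have "sup a c = c"
      using * by (metis inf_le2 sup_absorb2)
    ultimately show ?thesis
      using * \<open>c \<le> d\<close> by (simp add: inf_absorb1 inf_absorb2)
  next
    case 2
    then have *: "sup a d = b" "inf a d \<le> c"
      using prime_perspective_down_iff[OF q, of p] pq by auto
    have "(sup (inf a d) c, sup (inf b d) c) \<in> \<theta>"
      by (intro inf sup ab)
    moreover have "inf b d = d"
      using * by (metis sup_ge2 inf_absorb2)
    ultimately show ?thesis
      using * \<open>c \<le> d\<close> by (simp add: sup_absorb1 sup_absorb2)
  qed
  then show ?thesis
    using pq by (simp add: collapses_def)
qed

lemma prime_projective_collapses:
  assumes "prime_perspective\<^sup>*\<^sup>* p q"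
  shows "collapses (con p) q"
  using assms
  by induction (auto intro: collapses_con prime_perspective_collapses lattice_congruence_con)

lemma collapses_imp_prime_projective:
  fixes p q :: "'a::{finite,lattice} interval"
  assumes p: "prime_interval p" and q: "prime_interval q" and "collapses (con p) q"
  shows "prime_perspective\<^sup>*\<^sup>* p q"
proof -
  define S where "S a b \<longleftrightarrow> prime_perspective\<^sup>*\<^sup>* p (a, b)" for a b
  let ?\<theta> = "{(x, y). filled S (inf x y) (sup x y)}"
  have "closed_up S"
    unfolding closed_up_def
  proof (intro allI impI)
    fix u v a b :: 'a
    assume *: "covers v u" "covers b a" "S u v" "inf v a = u" "b \<le> sup v a"
    then have "prime_perspective (u, v) (a, b)"
      by (simp add: prime_perspective_def prime_interval_def covered_by_iff_covers
          prime_perspective_up_iff)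
    with * show "S a b"
      unfolding S_def by (meson rtranclp.rtrancl_into_rtrancl)
  qed
  moreover have "closed_down S"
    unfolding closed_down_def
  proof (intro allI impI)
    fix u v a b :: 'a
    assume *: "covers v u" "covers b a" "S u v" "sup u b = v" "inf u b \<le> a"
    then have "prime_perspective (u, v) (a, b)"
      by (simp add: prime_perspective_def prime_interval_def covered_by_iff_covers
          prime_perspective_down_iff)
    with * show "S a b"
      unfolding S_def by (meson rtranclp.rtrancl_into_rtrancl)
  qed
  ultimately have cong: "lattice_congruence ?\<theta>"
    by (rule lattice_congruence_filled)
  obtain a b c d where pq: "p = (a, b)" "q = (c, d)"
    by (metis surj_pair)
  have cov: "covers b a" "covers d c"
    using p q pq by (simp_all add: prime_interval_def covered_by_iff_covers)
  then have le: "a \<le> b" "c \<le> d"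
    by (simp_all add: covers_def less_imp_le)
  have "filled S a b"
    unfolding filled_def
  proof (intro allI impI)
    fix x y
    assume xy: "covers y x" "a \<le> x" "y \<le> b"
    then have "x < y"
      by (simp add: covers_def)
    with xy have "x \<le> b" "a \<le> y"
      by auto
    with xy \<open>x < y\<close> have "x = a" "y = b"
      using covers_between[OF cov(1), of x] covers_between[OF cov(1), of y] by auto
    then show "S x y"
      unfolding S_def pq by simp
  qed
  then have "collapses ?\<theta> p"
    using le pq by (simp add: collapses_def inf_absorb1 sup_absorb2)
  with cong have "con p \<subseteq> ?\<theta>"
    by (rule con_least)
  then have "filled S c d"
    using assms(3) le pq by (auto simp: collapses_def inf_absorb1 sup_absorb2)
  then show ?thesis
    using cov(2) unfolding filled_def S_def pq by simp
qed

text \<open>A walk that returns to a vertex is cut off at the first visit there; this keeps the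
  sequence injective when a step is appended.\<close>

lemma rtranclp_imp_injective_path:
  assumes "R\<^sup>*\<^sup>* x y"
  shows "\<exists>(n::nat) r. r 0 = x \<and> r n = y \<and> inj_on r {0..n} \<and> (\<forall>i<n. R (r i) (r (Suc i)))"
  using assms
proof induction
  case base
  show ?case
    by (rule exI[of _ 0]) auto
next
  case (step y z)
  then obtain n :: nat and r
    where r: "r 0 = x" "r n = y" "inj_on r {0..n}" "\<forall>i<n. R (r i) (r (Suc i))"
    by blast
  show ?case
  proof (cases "z \<in> r ` {0..n}")
    case True
    then obtain m where m: "m \<le> n" "r m = z"
      by auto
    then have "inj_on r {0..m}"
      using r(3) by (auto intro: inj_on_subset)
    with m r show ?thesis
      by (intro exI[of _ m] exI[of _ r]) auto
  next
    case False
    let ?r = "r(Suc n := z)"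
    have "inj_on ?r {0..Suc n}"
    proof -
      have "?r ` {0..n} = r ` {0..n}" "inj_on ?r {0..n}"
        using r(3) by (auto simp: inj_on_def)
      with False show ?thesis
        by (simp add: atLeast0_atMost_Suc)
    qed
    moreover have "\<forall>i<Suc n. R (?r i) (?r (Suc i))"
      using r step.hyps by (auto simp: less_Suc_eq)
    ultimately show ?thesis
      using r(1) by (intro exI[of _ "Suc n"] exI[of _ ?r]) (simp del: fun_upd_apply, simp)
  qed
qed

lemma path_imp_rtranclp:
  fixes n :: nat
  assumes "\<forall>i<n. R (r i) (r (Suc i))"
  shows "R\<^sup>*\<^sup>* (r 0) (r n)"
  using assms by (induction n) (auto intro: rtranclp.rtrancl_into_rtrancl)

theorem lemma5:
  fixes p q :: "'a::{finite,lattice} interval"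
  assumes "prime_interval p" and "prime_interval q" and "p \<noteq> q"
  shows "(collapses (con p) q \<longleftrightarrow> prime_projective p q) \<and>
    (collapses (con p) q \<longleftrightarrow>
      (\<exists>(n::nat) (r :: nat \<Rightarrow> 'a interval).
         r 0 = p \<and> r n = q \<and> inj_on r {0..n} \<and>
         (\<forall>i\<le>n. prime_interval (r i)) \<and>
         (\<forall>i<n. prime_perspective (r i) (r (Suc i)))))"
    (is "_ \<and> (_ \<longleftrightarrow> ?path)")
proof -
  have iff: "collapses (con p) q \<longleftrightarrow> prime_perspective\<^sup>*\<^sup>* p q"
    using collapses_imp_prime_projective[OF assms(1,2)] prime_projective_collapses by blast
  have "prime_perspective\<^sup>*\<^sup>* p q \<longleftrightarrow> prime_projective p q"
    using assms(3) unfolding prime_projective_def by (metis rtranclpD tranclp_into_rtranclp)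
  moreover have "prime_perspective\<^sup>*\<^sup>* p q \<longleftrightarrow> ?path"
  proof
    assume "prime_perspective\<^sup>*\<^sup>* p q"
    then obtain n :: nat and r
      where r: "r 0 = p" "r n = q" "inj_on r {0..n}"
        "\<forall>i<n. prime_perspective (r i) (r (Suc i))"
      using rtranclp_imp_injective_path[of prime_perspective p q] by blast
    have "\<forall>i\<le>n. prime_interval (r i)"
      using r(2,4) assms(2) unfolding prime_perspective_def by (metis le_neq_implies_less)
    with r show ?path by blast
  next
    assume ?path
    then show "prime_perspective\<^sup>*\<^sup>* p q"
      using path_imp_rtranclp[where R = prime_perspective] by blast
  qed
  ultimately show ?thesis
    using iff by blast
qed

end
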